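(* Let $m\ge2$, $\mathcal I=\{1,\dots,m\}$, let $H_1,\dots,H_m$ be hypotheses with $p$-values $(p_i)_{i\in\mathcal I}$, and for each $k\in\{1,\dots,m\}$ let functions $F_{(1)},\dots,F_{(k)}$ and $h$ satisfying conditions (C1), (C2), (C3) of the context be given. Assume that the underlying distribution of the $p$-values is exchangeable (so that the null CDF of $h(\boldsymbol Y^{\mathcal J})$ depends on $\mathcal J$ only through $|\mathcal J|$). Then the Closed Testing Procedure using $h(\boldsymbol Y^{\mathcal J})$ as test statistic for each joint hypothesis $H_{\mathcal J}$ (small values being critical) can be used to obtain control of the family-wise error rate for all marginal hypotheses in at most $\frac12 m(m-1)$ steps. That is: the adjusted $p$-values $p_i^\star=\max_{\mathcal J\subseteq\mathcal I,\ i\in\mathcal J}\phi^{\mathcal J}$, $i=1,\dots,m$, can all be determined, given the marginal $p$-values, by computing $\phi^{\mathcal J}$ for at most $\frac12 m(m-1)$ sets $\mathcal J$ with $|\mathcal J|\ge2$; and for every $\alpha\in[0,1]$, rejecting exactly those $H_i$ with $p_i^\star\le\alpha$ satisfies $\mathbb P(\text{at least one true } H_i \text{ is rejected})\le\alpha$, whichever of the hypotheses are true.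
   Context: For $\emptyset\ne\mathcal J\subseteq\mathcal I$ let $H_{\mathcal J}:=\bigcap_{j\in\mathcal J}H_j$, which is true iff all $H_j$, $j\in\mathcal J$, are true. For each size $k$, fix $\mathcal X\subseteq\mathbb R$, functions $F_{(1)},\dots,F_{(k)}:[0,1]\to\mathcal X$ and $h:\mathcal X^k\to[0,1]$ (these may depend on $k$). For $\mathcal J$ with $|\mathcal J|=k$ let $p^{\mathcal J}_{(1)}\le\dots\le p^{\mathcal J}_{(k)}$ be the sorted values of $(p_j)_{j\in\mathcal J}$ and $\boldsymbol Y^{\mathcal J}:=(F_{(1)}(p^{\mathcal J}_{(1)}),\dots,F_{(k)}(p^{\mathcal J}_{(k)}))$. The conditions are: (C1) each $F_{(j)}$ is nondecreasing: $F_{(j)}(x)\le F_{(j)}(x+\epsilon)$ for all $\epsilon\ge0$ with $x,x+\epsilon\in[0,1]$; (C2) $F_{(j)}(x)\ge F_{(j+1)}(x)$ for all $j\in\{1,\dots,k-1\}$ and $x\in[0,1]$; (C3) $h$ is nondecreasing in every coordinate: $h(\boldsymbol x)\le h(\boldsymbol x+\boldsymbol\epsilon)$ for all $\boldsymbol\epsilon\in[0,\infty)^k$ with $\boldsymbol x,\boldsymbol x+\boldsymbol\epsilon\in\mathcal X^k$. Exchangeability means that under the null, any two subsets of $p$-values of equal size have the same joint distribution; thus for each $k$ there is one CDF $G_k$ such that, whenever $|\mathcal J|=k$ and $H_{\mathcal J}$ is true, $h(\boldsymbol Y^{\mathcal J})$ has CDF $G_k$. The $p$-value of $H_{\mathcal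 J}$ is $\phi^{\mathcal J}:=G_{|\mathcal J|}(h(\boldsymbol Y^{\mathcal J}))$ for $|\mathcal J|\ge2$, and $\phi^{\{i\}}:=p_i$, where the marginal $p$-values are valid: $\mathbb P(p_i\le\alpha)\le\alpha$ for all $\alpha\in[0,1]$ if $H_i$ is true. The Closed Testing Procedure rejects $H_{\mathcal J}$ at level $\alpha$ iff $\phi^{\mathcal K}\le\alpha$ for every $\mathcal K$ with $\mathcal J\subseteq\mathcal K\subseteq\mathcal I$. A "step" is the computation of $\phi^{\mathcal J}$ for one set $\mathcal J$ with $|\mathcal J|\ge 2$ (the marginal $p$-values are supplied). *)

theory Defs
  imports "HOL-Probability.Probability"
begin

section \<open>Test statistics\<close>

text \<open>
  Everything that depends on the size of a joint hypothesis takes this size \<open>k\<close> as its first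
  argument. Vectors in \<open>X\<^sup>k\<close> are extensional functions on \<open>{1..k}\<close>; for these the pointwise order of
  the function type is the coordinatewise order, so \<open>mono_on\<close> below says that \<open>h k\<close> is nondecreasing
  in every coordinate.
\<close>

definition stat_family ::
  "nat \<Rightarrow> (nat \<Rightarrow> real set) \<Rightarrow> (nat \<Rightarrow> nat \<Rightarrow> real \<Rightarrow> real) \<Rightarrow> (nat \<Rightarrow> (nat \<Rightarrow> real) \<Rightarrow> real) \<Rightarrow> bool"
where
  "stat_family m X F h \<longleftrightarrow> (\<forall>k\<in>{1..m}.
     (\<forall>j\<in>{1..k}. F k j \<in> {0..1} \<rightarrow> X k) \<and>
     h k \<in> ({1..k} \<rightarrow>\<^sub>E X k) \<rightarrow> {0..1} \<and>
     (\<forall>j\<in>{1..k}. mono_on {0..1} (F k j)) \<and>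
     (\<forall>j\<in>{1..<k}. \<forall>t\<in>{0..1}. F k j t \<ge> F k (j + 1) t) \<and>
     mono_on ({1..k} \<rightarrow>\<^sub>E X k) (h k))"

definition order_stat :: "(nat \<Rightarrow> real) \<Rightarrow> nat set \<Rightarrow> nat \<Rightarrow> real" where
  "order_stat x J j = sort (map x (sorted_list_of_set J)) ! (j - 1)"

definition transformed :: "(nat \<Rightarrow> nat \<Rightarrow> real \<Rightarrow> real) \<Rightarrow> (nat \<Rightarrow> real) \<Rightarrow> nat set \<Rightarrow> nat \<Rightarrow> real" where
  "transformed F x J = (\<lambda>j\<in>{1..card J}. F (card J) j (order_stat x J j))"

definition test_stat ::
  "(nat \<Rightarrow> nat \<Rightarrow> real \<Rightarrow> real) \<Rightarrow> (nat \<Rightarrow> (nat \<Rightarrow> real) \<Rightarrow> real) \<Rightarrow> (nat \<Rightarrow> real) \<Rightarrow> nat set \<Rightarrow> real"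
where
  "test_stat F h x J = h (card J) (transformed F x J)"

text \<open>
  A coordinatewise monotone function of several variables need not be Borel, so measurability of the
  statistic as a function of \<open>k\<close> \<open>p\<close>-values in \<open>[0,1]\<close> has to be required separately.
\<close>

definition borel_stat ::
  "nat \<Rightarrow> (nat \<Rightarrow> nat \<Rightarrow> real \<Rightarrow> real) \<Rightarrow> (nat \<Rightarrow> (nat \<Rightarrow> real) \<Rightarrow> real) \<Rightarrow> bool"
where
  "borel_stat m F h \<longleftrightarrow> (\<forall>k\<in>{1..m}.
     (\<lambda>x. test_stat F h x {1..k})
       \<in> borel_measurable (PiM {1..k} (\<lambda>_. restrict_space borel {0..1})))"

section \<open>The statistical model\<close>

text \<open>
  A model is a set \<open>\<P>\<close> of possible distributions; a hypothesis is the set of those distributions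
  under which it is true.
\<close>

definition joint_hyp :: "(nat \<Rightarrow> 'a measure set) \<Rightarrow> nat set \<Rightarrow> 'a measure set" where
  "joint_hyp H J = (\<Inter>j\<in>J. H j)"

definition pvalue_model ::
  "nat \<Rightarrow> 'a measure set \<Rightarrow> (nat \<Rightarrow> 'a measure set) \<Rightarrow> (nat \<Rightarrow> 'a \<Rightarrow> real) \<Rightarrow> bool"
where
  "pvalue_model m \<P> H p \<longleftrightarrow>
     (\<forall>P\<in>\<P>. prob_space P) \<and>
     (\<forall>i\<in>{1..m}. H i \<subseteq> \<P>) \<and>
     (\<forall>P\<in>\<P>. \<forall>i\<in>{1..m}. p i \<in> borel_measurable P \<and> p i \<in> space P \<rightarrow> {0..1}) \<and>
     (\<forall>i\<in>{1..m}. \<forall>P\<in>H i. \<forall>\<alpha>\<in>{0..1}. measure P {\<omega> \<in> space P. p i \<omega> \<le> \<alpha>} \<le> \<alpha>)"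

text \<open>
  The injections \<open>f\<close> and \<open>g\<close> enumerate two index sets of the same size \<open>k\<close>, in an arbitrary order.
\<close>

definition exchangeable_null ::
  "nat \<Rightarrow> (nat \<Rightarrow> 'a measure set) \<Rightarrow> (nat \<Rightarrow> 'a \<Rightarrow> real) \<Rightarrow> bool"
where
  "exchangeable_null m H p \<longleftrightarrow>
     (\<forall>k\<in>{1..m}. \<forall>f\<in>{1..k} \<rightarrow> {1..m}. \<forall>g\<in>{1..k} \<rightarrow> {1..m}. inj_on f {1..k} \<longrightarrow> inj_on g {1..k} \<longrightarrow>
       (\<forall>P\<in>joint_hyp H (f ` {1..k}). \<forall>Q\<in>joint_hyp H (g ` {1..k}).
          distr P (PiM {1..k} (\<lambda>_. borel)) (\<lambda>\<omega>. \<lambda>j\<in>{1..k}. p (f j) \<omega>) =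
          distr Q (PiM {1..k} (\<lambda>_. borel)) (\<lambda>\<omega>. \<lambda>j\<in>{1..k}. p (g j) \<omega>)))"

definition cdf_family :: "nat \<Rightarrow> (nat \<Rightarrow> real \<Rightarrow> real) \<Rightarrow> bool" where
  "cdf_family m G \<longleftrightarrow> (\<forall>k\<in>{1..m}. \<exists>N. real_distribution N \<and> G k = cdf N)"

definition null_cdfs ::
  "nat \<Rightarrow> (nat \<Rightarrow> nat \<Rightarrow> real \<Rightarrow> real) \<Rightarrow> (nat \<Rightarrow> (nat \<Rightarrow> real) \<Rightarrow> real) \<Rightarrow>
     (nat \<Rightarrow> 'a measure set) \<Rightarrow> (nat \<Rightarrow> 'a \<Rightarrow> real) \<Rightarrow> (nat \<Rightarrow> real \<Rightarrow> real) \<Rightarrow> bool"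
where
  "null_cdfs m F h H p G \<longleftrightarrow> cdf_family m G \<and>
     (\<forall>J. J \<subseteq> {1..m} \<and> J \<noteq> {} \<longrightarrow> (\<forall>P\<in>joint_hyp H J.
        cdf (distr P borel (\<lambda>\<omega>. test_stat F h (\<lambda>i. p i \<omega>) J)) = G (card J)))"

section \<open>Closed testing\<close>

definition joint_pvalue ::
  "(nat \<Rightarrow> nat \<Rightarrow> real \<Rightarrow> real) \<Rightarrow> (nat \<Rightarrow> (nat \<Rightarrow> real) \<Rightarrow> real) \<Rightarrow> (nat \<Rightarrow> real \<Rightarrow> real) \<Rightarrow>
     (nat \<Rightarrow> real) \<Rightarrow> nat set \<Rightarrow> real"
where
  "joint_pvalue F h G x J =
     (if card J \<ge> 2 then G (card J) (test_stat F h x J) else x (the_elem J))"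

definition ctp_rejects :: "nat \<Rightarrow> (nat set \<Rightarrow> real) \<Rightarrow> real \<Rightarrow> nat set \<Rightarrow> bool" where
  "ctp_rejects m \<phi> \<alpha> J \<longleftrightarrow> (\<forall>K. J \<subseteq> K \<and> K \<subseteq> {1..m} \<longrightarrow> \<phi> K \<le> \<alpha>)"

definition adjusted_pvalue :: "nat \<Rightarrow> (nat set \<Rightarrow> real) \<Rightarrow> nat \<Rightarrow> real" where
  "adjusted_pvalue m \<phi> i = Max (\<phi> ` {J. J \<subseteq> {1..m} \<and> i \<in> J})"

section \<open>Counting steps\<close>

text \<open>
  An adaptive procedure that either reports its result or asks for \<open>\<phi> J\<close> for one set \<open>J\<close> and continues
  depending on the answer. It has no other access to \<open>\<phi>\<close>.
\<close>

datatype procedure = Report "nat \<Rightarrow> real" | Step "nat set" "real \<Rightarrow> procedure"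

primrec run :: "procedure \<Rightarrow> (nat set \<Rightarrow> real) \<Rightarrow> nat \<Rightarrow> real" where
  "run (Report r) \<phi> = r"
| "run (Step J c) \<phi> = run (c (\<phi> J)) \<phi>"

primrec steps :: "procedure \<Rightarrow> (nat set \<Rightarrow> real) \<Rightarrow> nat set list" where
  "steps (Report r) \<phi> = []"
| "steps (Step J c) \<phi> = J # steps (c (\<phi> J)) \<phi>"

definition computes_adjusted :: "nat \<Rightarrow> procedure \<Rightarrow> (nat set \<Rightarrow> real) \<Rightarrow> nat \<Rightarrow> bool" where
  "computes_adjusted m A \<phi> n \<longleftrightarrow>
     (\<forall>i\<in>{1..m}. run A \<phi> i = adjusted_pvalue m \<phi> i) \<and>
     (\<forall>J\<in>set (steps A \<phi>). J \<subseteq> {1..m} \<and> card J \<ge> 2) \<and>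
     length (steps A \<phi>) \<le> n"

text \<open>
  The event that at least one true hypothesis has an adjusted \<open>p\<close>-value of at most \<open>\<alpha>\<close>.
\<close>

definition false_rejection ::
  "nat \<Rightarrow> (nat \<Rightarrow> nat \<Rightarrow> real \<Rightarrow> real) \<Rightarrow> (nat \<Rightarrow> (nat \<Rightarrow> real) \<Rightarrow> real) \<Rightarrow> (nat \<Rightarrow> real \<Rightarrow> real) \<Rightarrow>
     (nat \<Rightarrow> 'a measure set) \<Rightarrow> (nat \<Rightarrow> 'a \<Rightarrow> real) \<Rightarrow> real \<Rightarrow> 'a measure \<Rightarrow> 'a set"
where
  "false_rejection m F h G H p \<alpha> P =
     {\<omega> \<in> space P. \<exists>i\<in>{1..m}. P \<in> H i \<and>
        adjusted_pvalue m (joint_pvalue F h G (\<lambda>i. p i \<omega>)) i \<le> \<alpha>}"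

end

theory Submission
  imports Defs
begin

text \<open>
  The adjusted \<open>p\<close>-value of \<open>H i\<close> is a maximum over exponentially many sets \<open>J\<close>, but for each size
  \<open>k\<close> one set suffices. Replacing the members of \<open>J\<close> other than \<open>i\<close> by the \<open>k - 1\<close> other hypotheses
  with the largest \<open>p\<close>-values lowers no order statistic; since the \<open>F k j\<close>, the statistic \<open>h k\<close> and
  the distribution function \<open>G k\<close> are all nondecreasing, it does not lower the joint \<open>p\<close>-value either
  (\<open>joint_pvalue_mono_exceedances\<close>, \<open>critical_set_dominates\<close>).

  Rank the hypotheses by increasing \<open>p\<close>-value, starting from rank 0. For size \<open>k = m - s + 1\<close> the sets
  that arise in this way consist of the \<open>k - 1\<close> hypotheses of ranks \<open>s, \<dots>, m - 1\<close> together with one of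
  smaller rank \<open>r\<close>: a hypothesis among the \<open>k\<close> largest shares the set with \<open>r = s - 1\<close>. So the relevant
  sets of at least two elements are indexed by the pairs \<open>r < s < m\<close>, of which there are \<open>m (m - 1) / 2\<close>.
  They depend on the marginal \<open>p\<close>-values only, so a procedure can ask for all of them without looking at
  the answers.

  Error control is the usual closure argument: let \<open>T\<close> be the set of all true hypotheses. If one of
  them is rejected, then the joint \<open>p\<close>-value of \<open>T\<close> is at most \<open>\<alpha>\<close>, and this has probability at most
  \<open>\<alpha>\<close>, because the joint hypothesis of \<open>T\<close> is true and a variable plugged into its own distribution
  function is a valid \<open>p\<close>-value (\<open>prob_cdf_le\<close>). The common null distribution functions exist because
  the statistic of \<open>J\<close> is one fixed Borel function of the vector \<open>(p j)\<^sub>j\<close>, in whatever order \<open>J\<close> is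
  enumerated, so exchangeability carries over from these vectors to the statistics.
\<close>

section \<open>Order statistics\<close>

lemma mset_sorted_list_of_set: "mset (sorted_list_of_set A) = mset_set A"
  by (metis mset_sorted_list_of_multiset sorted_list_of_mset_set)

lemma order_stat_mset:
  "order_stat x J j = sorted_list_of_multiset (image_mset x (mset_set J)) ! (j - 1)"
proof -
  have "mset (map x (sorted_list_of_set J)) = image_mset x (mset_set J)"
    by (simp add: mset_sorted_list_of_set)
  thus ?thesis unfolding order_stat_def by (metis sorted_list_of_multiset_mset)
qed

text \<open>
  Order statistics depend only on the multiset of values; this allows the statistic of an arbitrary
  index set to be pulled back to \<open>{1..k}\<close>, where measurability and exchangeability are stated.
\<close>

lemma order_stat_reindex:
  assumes "bij_betw f I J" "finite I"
  shows "order_stat x J j = order_stat (\<lambda>i\<in>I. x (f i)) I j"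
proof -
  have "mset_set J = image_mset f (mset_set I)"
    using assms by (metis bij_betw_def image_mset_mset_set)
  hence "image_mset x (mset_set J) = image_mset (\<lambda>i. x (f i)) (mset_set I)"
    by (simp add: image_mset.compositionality comp_def)
  also have "\<dots> = image_mset (\<lambda>i\<in>I. x (f i)) (mset_set I)"
    by (rule image_mset_cong) (use assms(2) in auto)
  finally show ?thesis by (simp add: order_stat_mset)
qed

lemma order_stat_in:
  assumes "finite J" "j \<in> {1..card J}" "x ` J \<subseteq> A"
  shows "order_stat x J j \<in> A"
proof -
  let ?l = "sort (map x (sorted_list_of_set J))"
  have "j - 1 < length ?l" using assms by auto
  hence "?l ! (j - 1) \<in> set ?l" by (rule nth_mem)
  also have "set ?l = x ` J" using assms(1) by simp
  finally show ?thesis using assms(3) by (auto simp: order_stat_def)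
qed

lemma card_exceedances:
  assumes "finite J"
  shows "card {i\<in>J. t < x i} = length (filter (\<lambda>v. t < v) (sort (map x (sorted_list_of_set J))))"
proof -
  have "length (filter (\<lambda>v. t < v) (sort (map x (sorted_list_of_set J))))
      = size (filter_mset (\<lambda>v. t < v) (image_mset x (mset_set J)))"
    by (metis mset_filter mset_map mset_sort mset_sorted_list_of_set size_mset)
  also have "\<dots> = card {i\<in>J. t < x i}"
    using assms by (simp add: filter_mset_image_mset)
  finally show ?thesis by simp
qed

text \<open>
  This turns the comparison of order statistics into the comparison of numbers of exceedances, which
  are easy to control under a change of the index set and insensitive to ties.
\<close>

lemma sorted_nth_le_iff_exceedances:
  fixes xs :: "'b::linorder list"
  assumes "sorted xs" "n < length xs"
  shows "xs ! n \<le> t \<longleftrightarrow> length (filter (\<lambda>v. t < v) xs) < length xs - n"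
proof (cases "xs ! n \<le> t")
  case True
  have "\<forall>v\<in>set (take (Suc n) xs). \<not> t < v"
  proof
    fix v assume "v \<in> set (take (Suc n) xs)"
    then obtain i where "i < Suc n" "v = xs ! i"
      using assms(2) by (auto simp: in_set_conv_nth)
    thus "\<not> t < v"
      using True sorted_nth_mono[OF assms(1), of i n] assms(2) by (auto simp: not_less)
  qed
  hence "filter (\<lambda>v. t < v) (take (Suc n) xs) = []" by simp
  hence "filter (\<lambda>v. t < v) xs = filter (\<lambda>v. t < v) (drop (Suc n) xs)"
    by (metis append_Nil append_take_drop_id filter_append)
  moreover have "length (filter (\<lambda>v. t < v) (drop (Suc n) xs)) \<le> length xs - Suc n"
    by (metis length_drop length_filter_le)
  ultimately show ?thesis using True assms(2) by simp
next
  case False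
  have "\<forall>v\<in>set (drop n xs). t < v"
  proof
    fix v assume "v \<in> set (drop n xs)"
    then obtain i where "i < length xs - n" "v = drop n xs ! i"
      by (auto simp: in_set_conv_nth)
    hence "n + i < length xs" "v = xs ! (n + i)" by auto
    thus "t < v"
      using False sorted_nth_mono[OF assms(1), of n "n + i"] by auto
  qed
  hence "filter (\<lambda>v. t < v) (drop n xs) = drop n xs" by simp
  hence "length (filter (\<lambda>v. t < v) xs) \<ge> length xs - n"
    by (metis append_take_drop_id filter_append le_add2 length_append length_drop)
  thus ?thesis using False by simp
qed

lemma order_stat_mono_exceedances:
  assumes "finite J" "finite C" "card J = card C" "j \<in> {1..card J}"
    and "\<And>t. card {i\<in>J. t < x i} \<le> card {i\<in>C. t < x i}"
  shows "order_stat x J j \<le> order_stat x C j"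
proof -
  let ?l = "\<lambda>J. sort (map x (sorted_list_of_set J))"
  define t where "t = order_stat x C j"
  have le_iff: "order_stat x K j \<le> t \<longleftrightarrow> card {i\<in>K. t < x i} < card K - (j - 1)"
    if "finite K" "card K = card C" for K
    using sorted_nth_le_iff_exceedances[of "?l K" "j - 1" t] assms(3,4) that
    by (auto simp: order_stat_def card_exceedances)
  have "card {i\<in>C. t < x i} < card C - (j - 1)"
    using le_iff[of C] assms(2) by (simp add: t_def)
  with assms(5)[of t] have "card {i\<in>J. t < x i} < card J - (j - 1)"
    using assms(3) by simp
  thus ?thesis using le_iff[of J] assms(1,3) by (simp add: t_def)
qed

text \<open>
  If \<open>U\<close> holds the largest values, then either all of them exceed \<open>t\<close>, and the cardinalities decide, or
  some member of \<open>U\<close> is at most \<open>t\<close>, and then so is every member of \<open>J\<close> outside \<open>U\<close>.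
\<close>

lemma exceedances_le_upper_set:
  fixes x :: "'i \<Rightarrow> real"
  assumes "finite J" "finite U" "card J \<le> card U"
    and upper: "\<And>u v. u \<in> U \<Longrightarrow> v \<in> J - U \<Longrightarrow> x v \<le> x u"
  shows "card {i\<in>J. t < x i} \<le> card {i\<in>U. t < x i}"
proof (cases "\<forall>u\<in>U. t < x u")
  case True
  hence "{i\<in>U. t < x i} = U" by auto
  moreover have "card {i\<in>J. t < x i} \<le> card J" by (rule card_mono) (use assms(1) in auto)
  ultimately show ?thesis using assms(3) by simp
next
  case False
  then obtain u where u: "u \<in> U" "x u \<le> t" by (auto simp: not_less)
  have "i \<in> U" if "i \<in> J" "t < x i" for i
    using upper[OF u(1), of i] u(2) that by (cases "i \<in> U") auto
  hence "{i\<in>J. t < x i} \<subseteq> {i\<in>U. t < x i}" by blast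
  thus ?thesis by (rule card_mono[rotated]) (use assms(2) in auto)
qed

section \<open>Monotonicity of the joint p-values\<close>

lemma stat_familyD:
  assumes "stat_family m X F h" "k \<in> {1..m}"
  shows "\<And>j. j \<in> {1..k} \<Longrightarrow> F k j \<in> {0..1} \<rightarrow> X k"
    and "\<And>j. j \<in> {1..k} \<Longrightarrow> mono_on {0..1} (F k j)"
    and "mono_on ({1..k} \<rightarrow>\<^sub>E X k) (h k)"
  using bspec[OF assms(1)[unfolded stat_family_def] assms(2)] by simp_all

lemma transformed_in_PiE:
  assumes "stat_family m X F h" "finite J" "card J \<in> {1..m}" "x ` J \<subseteq> {0..1}"
  shows "transformed F x J \<in> {1..card J} \<rightarrow>\<^sub>E X (card J)"
proof -
  have "F (card J) j (order_stat x J j) \<in> X (card J)" if "j \<in> {1..card J}" for j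
    by (rule funcset_mem[OF stat_familyD(1)[OF assms(1,3) that]
          order_stat_in[OF assms(2) that assms(4)]])
  thus ?thesis by (auto simp: transformed_def)
qed

lemma joint_pvalue_mono_exceedances:
  assumes fam: "stat_family m X F h" and cdf: "cdf_family m G"
    and fin: "finite J" "finite C" and card: "card J = card C" "card J \<in> {2..m}"
    and x: "x ` J \<subseteq> {0..1}" "x ` C \<subseteq> {0..1}"
    and exc: "\<And>t. card {i\<in>J. t < x i} \<le> card {i\<in>C. t < x i}"
  shows "joint_pvalue F h G x J \<le> joint_pvalue F h G x C"
proof -
  let ?k = "card J"
  have k: "?k \<in> {1..m}" "card C \<in> {1..m}" using card by auto
  have "transformed F x J j \<le> transformed F x C j" for j
  proof (cases "j \<in> {1..?k}")
    case True
    hence "j \<in> {1..card C}" using card(1) by simp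
    from order_stat_in[OF fin(1) True x(1)] order_stat_in[OF fin(2) this x(2)]
      order_stat_mono_exceedances[OF fin card(1) True exc]
    have "F ?k j (order_stat x J j) \<le> F ?k j (order_stat x C j)"
      by (rule mono_onD[OF stat_familyD(2)[OF fam k(1) True]])
    thus ?thesis using True card(1) by (simp add: transformed_def)
  next
    case False
    thus ?thesis using card(1) by (auto simp: transformed_def)
  qed
  hence le: "transformed F x J \<le> transformed F x C" by (rule le_funI)
  have "h ?k (transformed F x J) \<le> h ?k (transformed F x C)"
    using mono_onD[OF stat_familyD(3)[OF fam k(1)] transformed_in_PiE[OF fam fin(1) k(1) x(1)] _ le]
      transformed_in_PiE[OF fam fin(2) k(2) x(2)] unfolding card(1) by blast
  hence stat: "test_stat F h x J \<le> test_stat F h x C"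
    unfolding test_stat_def card(1) .
  obtain N where "real_distribution N" and N: "G ?k = cdf N"
    using cdf k(1) unfolding cdf_family_def by blast
  then interpret real_distribution N by simp
  have "G ?k (test_stat F h x J) \<le> G ?k (test_stat F h x C)"
    unfolding N by (rule cdf_nondecreasing[OF stat])
  thus ?thesis using card by (simp add: joint_pvalue_def)
qed

section \<open>The critical sets\<close>

definition by_rank :: "nat \<Rightarrow> (nat \<Rightarrow> real) \<Rightarrow> nat list" where
  "by_rank m x = sort_key x [1..<Suc m]"

text \<open>
  The pair \<open>r < s\<close> stands for the hypotheses of ranks \<open>s, \<dots>, m - 1\<close>, counted from 0, and the one of
  rank \<open>r\<close>. For \<open>s = 0\<close> the inner list is empty.
\<close>

definition critical_sets :: "nat \<Rightarrow> (nat \<Rightarrow> real) \<Rightarrow> nat set list" where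
  "critical_sets m x = concat (map (\<lambda>s. map (\<lambda>r.
     insert (by_rank m x ! r) (set (drop s (by_rank m x)))) [0..<s]) [0..<m])"

lemma by_rank:
  "length (by_rank m x) = m" "distinct (by_rank m x)" "set (by_rank m x) = {1..m}"
  "sorted (map x (by_rank m x))"
  by (auto simp: by_rank_def)

lemma length_critical_sets: "length (critical_sets m x) = m * (m - 1) div 2"
proof -
  have "length (critical_sets m x) = (\<Sum>s<m. s)"
    by (simp add: critical_sets_def length_concat comp_def interv_sum_list_conv_sum_set_nat
        atLeast0LessThan)
  thus ?thesis using Sum_Ico_nat[of 0 m] by (simp add: atLeast0LessThan)
qed

lemma set_critical_sets:
  "set (critical_sets m x) =
     {insert (by_rank m x ! r) (set (drop s (by_rank m x))) | r s. r < s \<and> s < m}"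
  unfolding critical_sets_def by fastforce

lemma card_drop_by_rank: "card (set (drop s (by_rank m x))) = m - s"
  by (simp add: distinct_card by_rank)

lemma nth_by_rank_notin_drop:
  "r < s \<Longrightarrow> s \<le> m \<Longrightarrow> by_rank m x ! r \<notin> set (drop s (by_rank m x))"
  using by_rank(1,2)[of m x] by (auto simp: in_set_conv_nth nth_eq_iff_index_eq)

lemma critical_set_props:
  assumes "C \<in> set (critical_sets m x)"
  shows "C \<subseteq> {1..m}" "card C \<ge> 2"
proof -
  obtain r s where C: "C = insert (by_rank m x ! r) (set (drop s (by_rank m x)))" "r < s" "s < m"
    using assms by (auto simp: set_critical_sets)
  have "by_rank m x ! r \<in> set (by_rank m x)" using C by (intro nth_mem) (simp add: by_rank)
  thus "C \<subseteq> {1..m}" using C set_drop_subset[of s "by_rank m x"] by (auto simp: by_rank)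
  show "card C \<ge> 2"
    using C nth_by_rank_notin_drop[of r s m x] card_drop_by_rank[of s m x] by simp
qed

lemma drop_by_rank_upper:
  assumes "u \<in> set (drop s (by_rank m x))" "v \<in> {1..m} - set (drop s (by_rank m x))"
  shows "x v \<le> x u"
proof -
  have "v \<in> set (take s (by_rank m x))"
    using assms(2) by_rank(3)[of m x] by (metis Diff_iff Un_iff append_take_drop_id set_append)
  moreover have "sorted (map x (take s (by_rank m x)) @ map x (drop s (by_rank m x)))"
    by (metis append_take_drop_id by_rank(4) map_append)
  ultimately show ?thesis using assms(1) by (auto simp: sorted_append)
qed

text \<open>
  Let \<open>k\<close> be the size of \<open>J\<close> and \<open>r\<close> the rank of \<open>i\<close>. If \<open>i\<close> is not among the \<open>k - 1\<close> largest, these are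
  compared with \<open>J - {i}\<close> and \<open>i\<close> is added on both sides. Otherwise the \<open>k\<close> largest contain \<open>i\<close> and can be
  compared with \<open>J\<close> itself.
\<close>

lemma critical_set_dominates:
  assumes fam: "stat_family m X F h" and cdf: "cdf_family m G"
    and x: "x ` {1..m} \<subseteq> {0..1}"
    and J: "J \<subseteq> {1..m}" "i \<in> J" "card J \<ge> 2"
  shows "\<exists>C\<in>set (critical_sets m x). i \<in> C \<and> joint_pvalue F h G x J \<le> joint_pvalue F h G x C"
proof -
  let ?L = "by_rank m x"
  have finJ: "finite J" using J finite_subset by blast
  have kle: "card J \<le> m" using J card_mono[of "{1..m}" J] by auto
  \<comment> \<open>the \<open>k - 1\<close> largest \<open>p\<close>-values, for \<open>k = card J\<close>, are those of rank at least \<open>s\<close>\<close>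
  define s where "s = Suc (m - card J)"
  have s: "0 < s" "s < m" "m - s = card J - 1" using J kle by (auto simp: s_def)
  obtain r where r: "r < m" "i = ?L ! r"
    using J by_rank(1,3)[of m x] by (metis in_set_conv_nth subsetD)
  have dominates: "joint_pvalue F h G x J \<le> joint_pvalue F h G x C"
    if "C \<subseteq> {1..m}" "card J = card C" "\<And>t. card {i\<in>J. t < x i} \<le> card {i\<in>C. t < x i}" for C
  proof (rule joint_pvalue_mono_exceedances[OF fam cdf finJ _ that(2) _ _ _ that(3)])
    show "finite C" using that(1) finite_subset by blast
    show "x ` J \<subseteq> {0..1}" "x ` C \<subseteq> {0..1}" using J(1) that(1) x by blast+
  qed (use J(3) kle in simp)
  show ?thesis
  proof (cases "r < s")
    case True
    let ?U = "set (drop s ?L)"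
    let ?C = "insert i ?U"
    have iU: "i \<notin> ?U" using nth_by_rank_notin_drop True r s by simp
    have mem: "?C \<in> set (critical_sets m x)"
      using True s r by (auto simp: set_critical_sets)
    have "card {j\<in>J. t < x j} \<le> card {j\<in>?C. t < x j}" for t
    proof -
      have "card {j\<in>J - {i}. t < x j} \<le> card {j\<in>?U. t < x j}"
      proof (rule exceedances_le_upper_set)
        show "card (J - {i}) \<le> card ?U" using finJ J card_drop_by_rank[of s m x] s by simp
        show "x v \<le> x u" if "u \<in> ?U" "v \<in> J - {i} - ?U" for u v
          using drop_by_rank_upper that J(1) by blast
      qed (use finJ in auto)
      moreover have "{j\<in>J. t < x j} =
          (if t < x i then insert i {j\<in>J - {i}. t < x j} else {j\<in>J - {i}. t < x j})"
        "{j\<in>?C. t < x j} = (if t < x i then insert i {j\<in>?U. t < x j} else {j\<in>?U. t < x j})"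
        using J iU by auto
      ultimately show ?thesis using finJ iU by simp
    qed
    moreover have "card J = card ?C"
      using iU card_drop_by_rank[of s m x] s J by simp
    ultimately show ?thesis
      using mem dominates critical_set_props(1)[OF mem] by blast
  next
    case False
    let ?C = "set (drop (s - 1) ?L)"
    have "drop (s - 1) ?L = ?L ! (s - 1) # drop s ?L"
      using Cons_nth_drop_Suc[of "s - 1" ?L] s by (simp add: by_rank)
    hence "?C = insert (?L ! (s - 1)) (set (drop s ?L))" by simp
    hence mem: "?C \<in> set (critical_sets m x)"
      unfolding set_critical_sets using s by (intro CollectI exI[of _ "s - 1"] exI[of _ s]) auto
    have "drop (s - 1) ?L ! (r - (s - 1)) \<in> ?C"
      using False r s by (intro nth_mem) (simp add: by_rank)
    hence "i \<in> ?C" using False r s by (simp add: by_rank)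
    moreover have card: "card J = card ?C" using card_drop_by_rank[of "s - 1" m x] kle
      by (simp add: s_def)
    moreover have "card {j\<in>J. t < x j} \<le> card {j\<in>?C. t < x j}" for t
    proof (rule exceedances_le_upper_set)
      show "x v \<le> x u" if "u \<in> ?C" "v \<in> J - ?C" for u v
        using drop_by_rank_upper that J(1) by blast
    qed (use finJ card in auto)
    ultimately show ?thesis
      using mem dominates critical_set_props(1)[OF mem] by blast
  qed
qed

section \<open>The procedure\<close>

text \<open>
  A procedure that asks for a fixed list of sets and reports a function of all answers. The argument
  \<open>known\<close> is an accumulator; its initial value supplies what is available without asking.
\<close>

primrec query ::
  "nat set list \<Rightarrow> ((nat set \<Rightarrow> real) \<Rightarrow> nat \<Rightarrow> real) \<Rightarrow> (nat set \<Rightarrow> real) \<Rightarrow> procedure"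
where
  "query [] report known = Report (report known)"
| "query (J # Js) report known = Step J (\<lambda>v. query Js report (known(J := v)))"

lemma steps_query: "steps (query Js report known) \<phi> = Js"
  by (induction Js arbitrary: known) auto

lemma run_query:
  "run (query Js report known) \<phi> = report (\<lambda>J. if J \<in> set Js then \<phi> J else known J)"
proof (induction Js arbitrary: known)
  case (Cons K Js)
  have "(\<lambda>J. if J \<in> set Js then \<phi> J else (known(K := \<phi> K)) J) =
      (\<lambda>J. if J \<in> set (K # Js) then \<phi> J else known J)" by auto
  thus ?case using Cons by simp
qed simp

text \<open>
  The marginal \<open>p\<close>-values enter through the initial value of the accumulator: it assigns \<open>x i\<close> to the
  singleton \<open>{i}\<close>, and singletons are not among the critical sets.
\<close>

definition shortcut :: "nat \<Rightarrow> (nat \<Rightarrow> real) \<Rightarrow> procedure" where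
  "shortcut m x = query (critical_sets m x)
     (\<lambda>\<psi> i. Max (\<psi> ` insert {i} {C \<in> set (critical_sets m x). i \<in> C}))
     (\<lambda>J. x (the_elem J))"

lemma Max_image_cofinal_subset:
  fixes f :: "'b \<Rightarrow> 'c::linorder"
  assumes "finite A" "B \<subseteq> A" "B \<noteq> {}" "\<And>a. a \<in> A \<Longrightarrow> \<exists>b\<in>B. f a \<le> f b"
  shows "Max (f ` B) = Max (f ` A)"
proof (rule antisym)
  have fin: "finite B" using assms finite_subset by blast
  show "Max (f ` B) \<le> Max (f ` A)" using assms by (intro Max_mono) auto
  show "Max (f ` A) \<le> Max (f ` B)"
    using assms fin by (subst Max_le_iff) (auto simp: Max_ge_iff)
qed

lemma computes_adjusted_shortcut:
  assumes fam: "stat_family m X F h" and cdf: "cdf_family m G"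
    and x: "x \<in> {1..m} \<rightarrow>\<^sub>E {0..1}"
  shows "computes_adjusted m (shortcut m x) (joint_pvalue F h G x) (m * (m - 1) div 2)"
  unfolding computes_adjusted_def
proof (intro conjI ballI)
  let ?\<phi> = "joint_pvalue F h G x"
  fix i assume i: "i \<in> {1..m}"
  let ?B = "insert {i} {C \<in> set (critical_sets m x). i \<in> C}"
  have "run (shortcut m x) ?\<phi> i = Max (?\<phi> ` ?B)"
    unfolding shortcut_def run_query
    by (intro arg_cong[of _ _ Max] image_cong) (auto simp: joint_pvalue_def)
  also have "\<dots> = Max (?\<phi> ` {J. J \<subseteq> {1..m} \<and> i \<in> J})"
  proof (rule Max_image_cofinal_subset)
    show "?B \<subseteq> {J. J \<subseteq> {1..m} \<and> i \<in> J}" using i critical_set_props(1) by blast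
    fix J assume J: "J \<in> {J. J \<subseteq> {1..m} \<and> i \<in> J}"
    show "\<exists>C\<in>?B. ?\<phi> J \<le> ?\<phi> C"
    proof (cases "card J \<ge> 2")
      case True
      have "x ` {1..m} \<subseteq> {0..1}" using x by auto
      from critical_set_dominates[OF fam cdf this, of J i] True J show ?thesis by blast
    next
      case False
      have "finite J" "J \<noteq> {}" using J finite_subset by auto
      hence "card J > 0" by (simp add: card_gt_0_iff)
      with False have "card J = 1" by simp
      then have "J = {i}" using J by (auto simp: card_1_singleton_iff)
      thus ?thesis by auto
    qed
  qed auto
  finally show "run (shortcut m x) ?\<phi> i = adjusted_pvalue m ?\<phi> i"
    unfolding adjusted_pvalue_def .
next
  fix J assume "J \<in> set (steps (shortcut m x) (joint_pvalue F h G x))"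
  hence "J \<in> set (critical_sets m x)" by (simp add: shortcut_def steps_query)
  thus "J \<subseteq> {1..m}" "2 \<le> card J" by (rule critical_set_props)+
next
  show "length (steps (shortcut m x) (joint_pvalue F h G x)) \<le> m * (m - 1) div 2"
    by (simp add: shortcut_def steps_query length_critical_sets)
qed

lemma adjusted_pvalue_le_iff:
  assumes "i \<in> {1..m}"
  shows "adjusted_pvalue m \<phi> i \<le> \<alpha> \<longleftrightarrow> (\<forall>J. J \<subseteq> {1..m} \<and> i \<in> J \<longrightarrow> \<phi> J \<le> \<alpha>)"
  unfolding adjusted_pvalue_def using assms
  by (subst Max_le_iff) auto

lemma ctp_rejects_iff_adjusted_pvalue:
  assumes "i \<in> {1..m}"
  shows "ctp_rejects m \<phi> \<alpha> {i} \<longleftrightarrow> adjusted_pvalue m \<phi> i \<le> \<alpha>"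
  using assms by (auto simp: adjusted_pvalue_le_iff ctp_rejects_def)

section \<open>Null distribution of the test statistics\<close>

lemma test_stat_reindex:
  assumes "bij_betw f {1..k} J"
  shows "test_stat F h x J = test_stat F h (\<lambda>j\<in>{1..k}. x (f j)) {1..k}"
proof -
  have "card J = k" using assms by (metis bij_betw_same_card card_atLeastAtMost diff_Suc_1)
  thus ?thesis
    using order_stat_reindex[OF assms, of x] by (simp add: test_stat_def transformed_def)
qed

text \<open>
  The statistic of \<open>{1..k}\<close> is assumed measurable on \<open>[0,1]\<^sup>k\<close> only, whereas exchangeability speaks of
  distributions on the whole product space. Clipping the coordinates to \<open>[0,1]\<close> extends the statistic
  measurably without changing it on vectors of \<open>p\<close>-values.
\<close>

definition clipped_stat ::
  "(nat \<Rightarrow> nat \<Rightarrow> real \<Rightarrow> real) \<Rightarrow> (nat \<Rightarrow> (nat \<Rightarrow> real) \<Rightarrow> real) \<Rightarrow> nat \<Rightarrow> (nat \<Rightarrow> real) \<Rightarrow> real"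
where
  "clipped_stat F h k y = test_stat F h (\<lambda>j\<in>{1..k}. max 0 (min 1 (y j))) {1..k}"

lemma clipped_stat_measurable:
  assumes "borel_stat m F h" "k \<in> {1..m}"
  shows "clipped_stat F h k \<in> borel_measurable (PiM {1..k} (\<lambda>_. borel))"
proof -
  have "(\<lambda>y. \<lambda>j\<in>{1..k}. max 0 (min 1 (y j)))
      \<in> PiM {1..k} (\<lambda>_. borel) \<rightarrow>\<^sub>M PiM {1..k} (\<lambda>_. restrict_space borel {0..1::real})"
    by (intro measurable_restrict measurable_restrict_space2) (auto simp: space_PiM)
  from measurable_compose[OF this] show ?thesis
    using assms unfolding borel_stat_def clipped_stat_def by blast
qed

lemma test_stat_eq_clipped:
  assumes "bij_betw f {1..k} J" "\<And>i. i \<in> J \<Longrightarrow> x i \<in> {0..1}"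
  shows "test_stat F h x J = clipped_stat F h k (\<lambda>j\<in>{1..k}. x (f j))"
proof -
  have "x (f j) \<in> {0..1}" if "j \<in> {1..k}" for j
    using assms that bij_betwE by blast
  hence "(\<lambda>j\<in>{1..k}. max 0 (min 1 ((\<lambda>j\<in>{1..k}. x (f j)) j))) = (\<lambda>j\<in>{1..k}. x (f j))"
    by (intro restrict_ext) auto
  thus ?thesis using test_stat_reindex[OF assms(1), of F h x] by (simp add: clipped_stat_def)
qed

text \<open>
  The law of the statistic of \<open>J\<close> is the image of the law of the vector of \<open>p\<close>-values, in the order
  given by \<open>f\<close>, under a map that depends on \<open>J\<close> only through its size.
\<close>

lemma
  assumes bor: "borel_stat m F h" and model: "pvalue_model m \<P> H p" and P: "P \<in> \<P>"
    and f: "bij_betw f {1..k} J" and J: "J \<subseteq> {1..m}" "J \<noteq> {}"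
  shows measurable_test_stat:
      "(\<lambda>\<omega>. test_stat F h (\<lambda>i. p i \<omega>) J) \<in> borel_measurable P"
    and distr_test_stat:
      "distr P borel (\<lambda>\<omega>. test_stat F h (\<lambda>i. p i \<omega>) J) =
       distr (distr P (PiM {1..k} (\<lambda>_. borel)) (\<lambda>\<omega>. \<lambda>j\<in>{1..k}. p (f j) \<omega>)) borel
         (clipped_stat F h k)"
proof -
  have fin: "finite J" using J finite_subset by blast
  have k: "k = card J" using f by (metis bij_betw_same_card card_atLeastAtMost diff_Suc_1)
  have "k \<in> {1..m}"
    using J fin card_mono[of "{1..m}" J] by (simp add: k Suc_le_eq card_gt_0_iff)
  note stat = clipped_stat_measurable[OF bor this]
  have fJ: "f j \<in> {1..m}" if "j \<in> {1..k}" for j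
    using f J that bij_betwE by blast
  have vec: "(\<lambda>\<omega>. \<lambda>j\<in>{1..k}. p (f j) \<omega>) \<in> P \<rightarrow>\<^sub>M PiM {1..k} (\<lambda>_. borel)"
    by (intro measurable_restrict) (use model P fJ in \<open>auto simp: pvalue_model_def\<close>)
  have eq: "test_stat F h (\<lambda>i. p i \<omega>) J = clipped_stat F h k (\<lambda>j\<in>{1..k}. p (f j) \<omega>)"
    if "\<omega> \<in> space P" for \<omega>
  proof (rule test_stat_eq_clipped[OF f])
    fix i assume "i \<in> J"
    hence "i \<in> {1..m}" using J(1) by blast
    hence "p i \<in> space P \<rightarrow> {0..1}" using model P unfolding pvalue_model_def by blast
    thus "p i \<omega> \<in> {0..1}" using that by blast
  qed
  have "(\<lambda>\<omega>. clipped_stat F h k (\<lambda>j\<in>{1..k}. p (f j) \<omega>)) \<in> borel_measurable P"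
    using measurable_compose[OF vec stat] .
  thus "(\<lambda>\<omega>. test_stat F h (\<lambda>i. p i \<omega>) J) \<in> borel_measurable P"
    using measurable_cong[of P, OF eq] by simp
  show "distr P borel (\<lambda>\<omega>. test_stat F h (\<lambda>i. p i \<omega>) J) =
       distr (distr P (PiM {1..k} (\<lambda>_. borel)) (\<lambda>\<omega>. \<lambda>j\<in>{1..k}. p (f j) \<omega>)) borel
         (clipped_stat F h k)"
    by (subst distr_distr[OF stat vec]) (intro distr_cong, use eq in \<open>auto simp: comp_def\<close>)
qed

lemma exchangeable_distr_test_stat:
  assumes bor: "borel_stat m F h" and model: "pvalue_model m \<P> H p"
    and exch: "exchangeable_null m H p"
    and J: "J \<subseteq> {1..m}" "J \<noteq> {}" "P \<in> joint_hyp H J"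
    and K: "K \<subseteq> {1..m}" "K \<noteq> {}" "Q \<in> joint_hyp H K"
    and card: "card J = card K"
  shows "distr P borel (\<lambda>\<omega>. test_stat F h (\<lambda>i. p i \<omega>) J) =
         distr Q borel (\<lambda>\<omega>. test_stat F h (\<lambda>i. p i \<omega>) K)"
proof -
  let ?k = "card J"
  have fin: "finite J" "finite K" using J K finite_subset by blast+
  have PQ: "P \<in> \<P>" "Q \<in> \<P>"
    using model J K unfolding pvalue_model_def joint_hyp_def by blast+
  have k: "?k \<in> {1..m}"
    using J fin card_mono[of "{1..m}" J] by (simp add: Suc_le_eq card_gt_0_iff)
  obtain f where f: "bij_betw f {1..?k} J" using ex_bij_betw_nat_finite_1[OF fin(1)] by blast
  obtain g where g: "bij_betw g {1..?k} K" using ex_bij_betw_nat_finite_1[OF fin(2)] card by auto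
  have im: "f ` {1..?k} = J" "g ` {1..?k} = K" "inj_on f {1..?k}" "inj_on g {1..?k}"
    using f g by (auto simp: bij_betw_def)
  have maps: "f \<in> {1..?k} \<rightarrow> {1..m}" "g \<in> {1..?k} \<rightarrow> {1..m}" using im J K by blast+
  have "distr P (PiM {1..?k} (\<lambda>_. borel)) (\<lambda>\<omega>. \<lambda>j\<in>{1..?k}. p (f j) \<omega>) =
         distr Q (PiM {1..?k} (\<lambda>_. borel)) (\<lambda>\<omega>. \<lambda>j\<in>{1..?k}. p (g j) \<omega>)"
    using bspec[OF bspec[OF bspec[OF exch[unfolded exchangeable_null_def] k] maps(1)] maps(2)]
      im J(3) K(3) by simp
  thus ?thesis
    using distr_test_stat[OF bor model PQ(1) f J(1,2)] distr_test_stat[OF bor model PQ(2) g K(1,2)]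
    by simp
qed

lemma null_cdfs_exist:
  assumes bor: "borel_stat m F h" and model: "pvalue_model m \<P> H p"
    and exch: "exchangeable_null m H p"
  shows "\<exists>G. null_cdfs m F h H p G"
proof -
  let ?N = "\<lambda>P J. distr P borel (\<lambda>\<omega>. test_stat F h (\<lambda>i. p i \<omega>) J)"
  have "\<exists>g. (\<exists>N. real_distribution N \<and> g = cdf N) \<and>
      (\<forall>J P. J \<subseteq> {1..m} \<and> J \<noteq> {} \<and> card J = k \<and> P \<in> joint_hyp H J \<longrightarrow> cdf (?N P J) = g)" for k
  proof (cases "\<exists>J P. J \<subseteq> {1..m} \<and> J \<noteq> {} \<and> card J = k \<and> P \<in> joint_hyp H J")
    case True
    then obtain J P where J: "J \<subseteq> {1..m}" "J \<noteq> {}" "card J = k" "P \<in> joint_hyp H J" by blast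
    have P: "P \<in> \<P>" using model J unfolding pvalue_model_def joint_hyp_def by blast
    have "finite J" using J finite_subset by blast
    then obtain f where "bij_betw f {1..card J} J" using ex_bij_betw_nat_finite_1 by blast
    from measurable_test_stat[OF bor model P this J(1,2)]
    have meas: "(\<lambda>\<omega>. test_stat F h (\<lambda>i. p i \<omega>) J) \<in> borel_measurable P" .
    interpret prob_space P using model P by (simp add: pvalue_model_def)
    have "real_distribution (?N P J)" using meas by (rule real_distribution_distr)
    moreover have "cdf (?N Q K) = cdf (?N P J)"
      if "K \<subseteq> {1..m} \<and> K \<noteq> {} \<and> card K = k \<and> Q \<in> joint_hyp H K" for K Q
      using exchangeable_distr_test_stat[OF bor model exch J(1,2,4), of K Q] that J(3) by simp
    ultimately show ?thesis by blast
  next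
    \<comment> \<open>if no joint hypothesis of size \<open>k\<close> can be true, any distribution function will do\<close>
    case False
    have "real_distribution (return borel (0::real))"
      by (intro real_distribution.intro real_distribution_axioms.intro prob_space_return) auto
    thus ?thesis using False by blast
  qed
  then obtain G where "\<And>k. (\<exists>N. real_distribution N \<and> G k = cdf N) \<and>
      (\<forall>J P. J \<subseteq> {1..m} \<and> J \<noteq> {} \<and> card J = k \<and> P \<in> joint_hyp H J \<longrightarrow> cdf (?N P J) = G k)"
    by metis
  hence "null_cdfs m F h H p G" unfolding null_cdfs_def cdf_family_def by auto
  thus ?thesis by (rule exI[of _ G])
qed

section \<open>Family-wise error control\<close>

text \<open>
  The set \<open>{t. cdf M t \<le> \<alpha>}\<close> is closed downwards, but may lack a greatest element. Inner regularity
  supplies one: were its probability above \<open>\<alpha>\<close>, so would be that of a compact subset; this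
  has a greatest element \<open>s\<close>, so its probability is at most \<open>cdf M s\<close>, which is at most \<open>\<alpha>\<close>.
\<close>

lemma (in real_distribution) prob_cdf_le:
  assumes "0 \<le> \<alpha>"
  shows "prob {t. cdf M t \<le> \<alpha>} \<le> \<alpha>"
proof (rule ccontr)
  let ?A = "{t. cdf M t \<le> \<alpha>}"
  assume "\<not> ?thesis"
  hence less: "\<alpha> < prob ?A" by simp
  have "cdf M \<in> borel_measurable borel"
    by (intro borel_measurable_mono monoI cdf_nondecreasing)
  hence A: "?A \<in> sets borel" by measurable
  have "emeasure M ?A = (SUP K\<in>{K. K \<subseteq> ?A \<and> compact K}. emeasure M K)"
    by (rule inner_regular) (use A emeasure_finite in auto)
  moreover have "ennreal \<alpha> < emeasure M ?A"
    using less assms by (simp add: emeasure_eq_measure ennreal_less_iff)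
  ultimately obtain K where K: "K \<subseteq> ?A" "compact K" "ennreal \<alpha> < emeasure M K"
    by (auto simp: less_SUP_iff)
  have K': "\<alpha> < prob K" using K(3) assms by (simp add: emeasure_eq_measure ennreal_less_iff)
  hence "K \<noteq> {}" using assms by auto
  then obtain s where s: "s \<in> K" "\<And>t. t \<in> K \<Longrightarrow> t \<le> s"
    using compact_attains_sup[OF K(2)] by blast
  have "prob K \<le> prob {..s}" by (rule finite_measure_mono) (use s in auto)
  also have "\<dots> = cdf M s" by (simp add: cdf_def)
  also have "\<dots> \<le> \<alpha>" using K s by blast
  finally show False using K' by simp
qed

lemma
  assumes bor: "borel_stat m F h" and model: "pvalue_model m \<P> H p"
    and null: "null_cdfs m F h H p G" and P: "P \<in> \<P>" and J: "J \<subseteq> {1..m}" "J \<noteq> {}"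
  shows measurable_joint_pvalue:
      "(\<lambda>\<omega>. joint_pvalue F h G (\<lambda>i. p i \<omega>) J) \<in> borel_measurable P"
    and joint_pvalue_valid: "P \<in> joint_hyp H J \<Longrightarrow> \<alpha> \<in> {0..1} \<Longrightarrow>
      measure P {\<omega> \<in> space P. joint_pvalue F h G (\<lambda>i. p i \<omega>) J \<le> \<alpha>} \<le> \<alpha>"
proof -
  let ?S = "\<lambda>\<omega>. test_stat F h (\<lambda>i. p i \<omega>) J"
  interpret prob_space P using model P by (simp add: pvalue_model_def)
  have fin: "finite J" using J finite_subset by blast
  then obtain f where "bij_betw f {1..card J} J" using ex_bij_betw_nat_finite_1 by blast
  note S = measurable_test_stat[OF bor model P this J]
  have k: "card J \<in> {1..m}"
    using J fin card_mono[of "{1..m}" J] by (simp add: Suc_le_eq card_gt_0_iff)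
  obtain N where "real_distribution N" and GN: "G (card J) = cdf N"
    using null k unfolding null_cdfs_def cdf_family_def by blast
  then interpret N: real_distribution N by simp
  have G: "G (card J) \<in> borel_measurable borel"
    unfolding GN by (intro borel_measurable_mono monoI N.cdf_nondecreasing)
  have single: "\<exists>i\<in>{1..m}. J = {i}" if "\<not> card J \<ge> 2"
  proof -
    have "card J = 1" using that k by auto
    thus ?thesis using J by (auto simp: card_1_singleton_iff)
  qed
  show "(\<lambda>\<omega>. joint_pvalue F h G (\<lambda>i. p i \<omega>) J) \<in> borel_measurable P"
  proof (cases "card J \<ge> 2")
    case True
    thus ?thesis using measurable_compose[OF S G] by (simp add: joint_pvalue_def)
  next
    case False
    thus ?thesis using single model P by (auto simp: joint_pvalue_def pvalue_model_def)
  qed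
  assume PJ: "P \<in> joint_hyp H J" and \<alpha>: "\<alpha> \<in> {0..1}"
  show "measure P {\<omega> \<in> space P. joint_pvalue F h G (\<lambda>i. p i \<omega>) J \<le> \<alpha>} \<le> \<alpha>"
  proof (cases "card J \<ge> 2")
    case True
    interpret D: real_distribution "distr P borel ?S" using S by (rule real_distribution_distr)
    have Geq: "G (card J) = cdf (distr P borel ?S)"
      using null J PJ unfolding null_cdfs_def by auto
    have "{t. G (card J) t \<le> \<alpha>} \<in> sets borel" using G by measurable
    hence "measure P {\<omega> \<in> space P. joint_pvalue F h G (\<lambda>i. p i \<omega>) J \<le> \<alpha>} =
        measure (distr P borel ?S) {t. cdf (distr P borel ?S) t \<le> \<alpha>}"
      using True S unfolding Geq[symmetric]
      by (auto simp: measure_distr joint_pvalue_def vimage_def Int_def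
          intro!: arg_cong[of _ _ "measure P"])
    also have "\<dots> \<le> \<alpha>" using D.prob_cdf_le \<alpha> by simp
    finally show ?thesis .
  next
    case False
    then obtain i where "i \<in> {1..m}" "J = {i}" using single by blast
    moreover from this have "P \<in> H i" using PJ by (simp add: joint_hyp_def)
    ultimately show ?thesis using model \<alpha> by (simp add: joint_pvalue_def pvalue_model_def)
  qed
qed

lemma
  assumes bor: "borel_stat m F h" and model: "pvalue_model m \<P> H p"
    and null: "null_cdfs m F h H p G" and P: "P \<in> \<P>"
  shows false_rejection_measurable: "false_rejection m F h G H p \<alpha> P \<in> sets P"
    and prob_false_rejection_le:
      "\<alpha> \<in> {0..1} \<Longrightarrow> measure P (false_rejection m F h G H p \<alpha> P) \<le> \<alpha>"
proof -
  let ?\<phi> = "\<lambda>\<omega>. joint_pvalue F h G (\<lambda>i. p i \<omega>)"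
  let ?R = "false_rejection m F h G H p \<alpha> P"
  interpret prob_space P using model P by (simp add: pvalue_model_def)
  have meas: "{\<omega> \<in> space P. ?\<phi> \<omega> J \<le> \<alpha>} \<in> sets P" if "J \<subseteq> {1..m}" "J \<noteq> {}" for J
    using measurable_joint_pvalue[OF bor model null P that] by measurable
  have "?R = (\<Union>i\<in>{i\<in>{1..m}. P \<in> H i}.
      \<Inter>J\<in>{J. J \<subseteq> {1..m} \<and> i \<in> J}. {\<omega> \<in> space P. ?\<phi> \<omega> J \<le> \<alpha>})"
    by (auto simp: false_rejection_def adjusted_pvalue_le_iff)
  also have "\<dots> \<in> sets P"
    by (intro sets.finite_UN sets.finite_INT meas) auto
  finally show "?R \<in> sets P" .
  assume \<alpha>: "\<alpha> \<in> {0..1}"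
  \<comment> \<open>a true hypothesis is rejected only if every joint hypothesis containing it is, so only if that
    of all true hypotheses is\<close>
  define T where "T = {i\<in>{1..m}. P \<in> H i}"
  have T: "T \<subseteq> {1..m}" "P \<in> joint_hyp H T" by (auto simp: T_def joint_hyp_def)
  show "measure P ?R \<le> \<alpha>"
  proof (cases "T = {}")
    case True
    hence "?R = {}" by (auto simp: false_rejection_def T_def)
    thus ?thesis using \<alpha> by simp
  next
    case False
    have "?R \<subseteq> {\<omega> \<in> space P. ?\<phi> \<omega> T \<le> \<alpha>}"
    proof
      fix \<omega> assume "\<omega> \<in> ?R"
      then obtain i where i: "\<omega> \<in> space P" "i \<in> {1..m}" "P \<in> H i"
        and adj: "adjusted_pvalue m (?\<phi> \<omega>) i \<le> \<alpha>"
        unfolding false_rejection_def by blast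
      have "T \<subseteq> {1..m} \<and> i \<in> T" using i(2,3) T(1) by (simp add: T_def)
      with adj have "?\<phi> \<omega> T \<le> \<alpha>" unfolding adjusted_pvalue_le_iff[OF i(2)] by simp
      thus "\<omega> \<in> {\<omega> \<in> space P. ?\<phi> \<omega> T \<le> \<alpha>}" using i(1) by simp
    qed
    from finite_measure_mono[OF this meas[OF T(1) False]]
    have "measure P ?R \<le> measure P {\<omega> \<in> space P. ?\<phi> \<omega> T \<le> \<alpha>}" .
    also have "\<dots> \<le> \<alpha>" by (rule joint_pvalue_valid[OF bor model null P T(1) False T(2) \<alpha>])
    finally show ?thesis .
  qed
qed

theorem theorem4:
  fixes m :: nat
  assumes "m \<ge> 2"
  shows "\<exists>A :: (nat \<Rightarrow> real) \<Rightarrow> procedure. \<forall>X F h. stat_family m X F h \<longrightarrow>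
    (\<forall>G. \<forall>x\<in>{1..m} \<rightarrow>\<^sub>E {0..1}. cdf_family m G \<longrightarrow>
       computes_adjusted m (A x) (joint_pvalue F h G x) (m * (m - 1) div 2) \<and>
       (\<forall>i\<in>{1..m}. \<forall>\<alpha>\<in>{0..1}. ctp_rejects m (joint_pvalue F h G x) \<alpha> {i} \<longleftrightarrow>
          adjusted_pvalue m (joint_pvalue F h G x) i \<le> \<alpha>)) \<and>
    (\<forall>(\<P> :: 'a measure set) H p.
       borel_stat m F h \<and> pvalue_model m \<P> H p \<and> exchangeable_null m H p \<longrightarrow>
       (\<exists>G. null_cdfs m F h H p G) \<and>
       (\<forall>G. null_cdfs m F h H p G \<longrightarrow> (\<forall>P\<in>\<P>. \<forall>\<alpha>\<in>{0..1}.
          false_rejection m F h G H p \<alpha> P \<in> sets P \<and>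
          measure P (false_rejection m F h G H p \<alpha> P) \<le> \<alpha>)))"
proof (rule exI[of _ "shortcut m"], intro allI impI conjI ballI)
  fix X F h G x
  assume fam: "stat_family m X F h" and x: "x \<in> {1..m} \<rightarrow>\<^sub>E {0..1::real}" and G: "cdf_family m G"
  show "computes_adjusted m (shortcut m x) (joint_pvalue F h G x) (m * (m - 1) div 2)"
    by (rule computes_adjusted_shortcut[OF fam G x])
next
  fix F h G x i and \<alpha> :: real
  assume "i \<in> {1..m}"
  thus "ctp_rejects m (joint_pvalue F h G x) \<alpha> {i} \<longleftrightarrow>
          adjusted_pvalue m (joint_pvalue F h G x) i \<le> \<alpha>"
    by (rule ctp_rejects_iff_adjusted_pvalue)
next
  fix F h H p and \<P> :: "'a measure set"
  assume "borel_stat m F h \<and> pvalue_model m \<P> H p \<and> exchangeable_null m H p"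
  hence "borel_stat m F h" "pvalue_model m \<P> H p" "exchangeable_null m H p" by simp_all
  thus "\<exists>G. null_cdfs m F h H p G" by (rule null_cdfs_exist)
next
  fix F h H p G P \<alpha> and \<P> :: "'a measure set"
  assume *: "borel_stat m F h \<and> pvalue_model m \<P> H p \<and> exchangeable_null m H p"
    and null: "null_cdfs m F h H p G" and P: "P \<in> \<P>" and \<alpha>: "\<alpha> \<in> {0..1::real}"
  note model = conjunct1[OF *] conjunct1[OF conjunct2[OF *]]
  show "false_rejection m F h G H p \<alpha> P \<in> sets P"
    by (rule false_rejection_measurable[OF model null P])
  show "measure P (false_rejection m F h G H p \<alpha> P) \<le> \<alpha>"
    by (rule prob_false_rejection_le[OF model null P \<alpha>])
qed

end
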